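(* Let $0<a,b,c\leq 1$ be real numbers with $\min(a,b,c)+\max(a,b,c)>1$. For a positive integer $N$, let $\mathcal{N}(a,b,c,N)$ denote the number of triples $(A,B,C)$ of relatively prime integers with $A+B+C=0$, $|A|,|B|,|C|\leq N$, and $r(A)\leq |A|^a$, $r(B)\leq |B|^b$, $r(C)\leq |C|^c$. Then $\mathcal{N}(a,b,c,N)=\Omega(N^{a+b+c-1})$; that is, there is a constant $\kappa>0$ (depending on $a,b,c$) such that $\mathcal{N}(a,b,c,N)\geq \kappa N^{a+b+c-1}$ for all sufficiently large $N$.
   Context: For a nonzero integer $n$, $r(n)=\prod_{p\mid n}p$ denotes the product of the distinct primes dividing $n$ (the radical of $n$). Triples are counted as ordered triples. *)

theory Defs
  imports
    Complex_Main
    "HOL-Computational_Algebra.Primes"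
    "HOL-Library.Landau_Symbols"
begin

(* On int, prime_factors consists of positive primes and ignores signs.
   Only nonzero arguments are meaningful; rad 0 = 1 is an artefact. *)
definition rad :: "int \<Rightarrow> int" where
  "rad n = (\<Prod>p\<in>prime_factors n. p)"

(* The radical is defined for nonzero integers only, so A, B, C are required to be nonzero. *)
definition abc_triples :: "real \<Rightarrow> real \<Rightarrow> real \<Rightarrow> nat \<Rightarrow> (int \<times> int \<times> int) set" where
  "abc_triples a b c N = {(A, B, C).
     A \<noteq> 0 \<and> B \<noteq> 0 \<and> C \<noteq> 0 \<and>
     Gcd {A, B, C} = 1 \<and>
     A + B + C = 0 \<and>
     \<bar>A\<bar> \<le> int N \<and> \<bar>B\<bar> \<le> int N \<and> \<bar>C\<bar> \<le> int N \<and>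
     real_of_int (rad A) \<le> real_of_int \<bar>A\<bar> powr a \<and>
     real_of_int (rad B) \<le> real_of_int \<bar>B\<bar> powr b \<and>
     real_of_int (rad C) \<le> real_of_int \<bar>C\<bar> powr c}"

definition abc_count :: "real \<Rightarrow> real \<Rightarrow> real \<Rightarrow> nat \<Rightarrow> nat" where
  "abc_count a b c N = card (abc_triples a b c N)"

text \<open>The set of triples is finite, so its cardinality is the genuine count.\<close>

lemma finite_abc_triples: "finite (abc_triples a b c N)"
proof (rule finite_subset)
  let ?I = "{- int N..int N}"
  show "abc_triples a b c N \<subseteq> ?I \<times> ?I \<times> ?I"
    by (auto simp: abc_triples_def)
  show "finite (?I \<times> ?I \<times> ?I)"
    by simp
qed

end

(* Force A, B, C to be multiples of 2^x, 3^y, 5^z, of size about N^(1-a), N^(1-b), N^(1-c):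
   this alone bounds their radicals as required. When a + c > 1, every admissible B leaves
   about N^(a+c-1) choices for A, which range over an arithmetic progression modulo 2^x * 5^z,
   and there are about N^b choices for B.  The powers of 2, 3, 5 are kept coprime by
   congruences.  The pairs (A, B) with a common prime p >= 7 are a fraction of about 1/p^2,
   and the sum of 1/p^2 over p >= 7 is at most 1/6, so a positive proportion of all pairs is
   coprime.  The hypothesis on the exponents gives a + c > 1 or a + b > 1, and the two cases
   are exchanged by swapping B and C. *)
theory Submission
  imports Defs "HOL-Number_Theory.Totient" "HOL-Real_Asymp.Real_Asymp"
begin

section \<open>Radicals\<close>

lemma rad_pos: "rad n > 0"
  unfolding rad_def by (intro prod_pos) (auto simp: in_prime_factors_iff prime_gt_0_int)

lemma rad_dvd: "rad n dvd n"
proof (cases "n = 0")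
  case False
  have "rad n dvd (\<Prod>p\<in>prime_factors n. p ^ multiplicity p n)"
    unfolding rad_def
    by (intro prod_dvd_prod) (auto simp: prime_factors_multiplicity dvd_power)
  also have "\<dots> dvd n"
    using prod_prime_factors[OF False] by (simp add: normalize_dvd_iff)
  finally show ?thesis .
qed simp

text \<open>Only the set of primes counts, so the exponent of \<open>p\<close> can drop to
  1.\<close>

lemma rad_mult_prime_power:
  assumes "prime p" "k > 0" "m \<noteq> 0"
  shows "rad (p ^ k * m) = rad (p * m)"
proof -
  have "p \<noteq> 0" using assms by auto
  then have "prime_factors (p ^ k * m) = prime_factors (p * m)"
    using assms by (simp add: prime_factors_product prime_factors_power)
  then show ?thesis by (simp add: rad_def)
qed

text \<open>Writing n = p^k * m, the radical divides p * m, so it is at most |n| * (p / p^k). By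
  \<open>large\<close> and |n| \<le> X, the quotient p / p^k is at most |n| powr (a - 1); the bound
  \<open>a \<le> 1\<close> makes |n| powr (1 - a) increase with |n|.\<close>

lemma rad_le_powr:
  fixes n :: int and a X :: real
  assumes p: "prime p" and k: "k > 0" and dvd: "p ^ k dvd n" and n: "n \<noteq> 0"
    and nX: "real_of_int \<bar>n\<bar> \<le> X" and a: "a \<le> 1"
    and large: "real_of_int p * X powr (1 - a) \<le> real_of_int p ^ k"
  shows "real_of_int (rad n) \<le> real_of_int \<bar>n\<bar> powr a"
proof -
  obtain m where m: "n = p ^ k * m" using dvd by auto
  have m0: "m \<noteq> 0" and p0: "p > 0" using m n p by (auto simp: prime_gt_0_int)
  have "rad n \<le> \<bar>p * m\<bar>"
    using rad_dvd[of "p * m"] dvd_imp_le_int[of "p * m" "rad n"] m0 p0 rad_pos[of n]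
    by (simp add: m rad_mult_prime_power[OF p k m0])
  then have "real_of_int (rad n) \<le> real_of_int p * real_of_int \<bar>m\<bar>"
    by (metis abs_mult abs_of_pos of_int_le_iff of_int_mult p0)
  also have "\<dots> = real_of_int \<bar>n\<bar> * (real_of_int p / real_of_int p ^ k)"
    using p0 by (simp add: m abs_mult)
  also have "\<dots> \<le> real_of_int \<bar>n\<bar> * real_of_int \<bar>n\<bar> powr (a - 1)"
  proof (rule mult_left_mono)
    have "real_of_int p * real_of_int \<bar>n\<bar> powr (1 - a) \<le> real_of_int p * X powr (1 - a)"
      using nX a p0 by (intro mult_left_mono powr_mono2) auto
    also note large
    finally have "real_of_int p * real_of_int \<bar>n\<bar> powr (1 - a) \<le> real_of_int p ^ k" .
    then have "real_of_int p / real_of_int p ^ k \<le> 1 / real_of_int \<bar>n\<bar> powr (1 - a)"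
      using n p0 by (simp add: divide_simps mult_ac)
    also have "\<dots> = real_of_int \<bar>n\<bar> powr (a - 1)"
      using powr_minus_divide[of "real_of_int \<bar>n\<bar>" "1 - a"] by simp
    finally show "real_of_int p / real_of_int p ^ k \<le> real_of_int \<bar>n\<bar> powr (a - 1)" .
  qed simp
  also have "\<dots> = real_of_int \<bar>n\<bar> powr a"
    using n by (simp add: powr_diff)
  finally show ?thesis .
qed

section \<open>Coprime pairs in arithmetic progressions\<close>

text \<open>Since \<open>m\<close> is invertible modulo \<open>p\<close>, the admissible
  \<open>j\<close> lie in a single residue class, so each block of \<open>p\<close> consecutive
  integers holds at most one of them. The summand 1 pays for the incomplete last block.\<close>

lemma card_dvd_progression_le:
  fixes p m s n :: nat
  assumes "coprime p m" "p > 0"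
  shows "real (card {j. j < n \<and> p dvd s + m * j}) \<le> real n / real p + 1"
proof -
  let ?S = "{j. j < n \<and> p dvd s + m * j}"
  have "inj_on (\<lambda>j. j div p) ?S"
  proof (rule inj_onI)
    fix i j assume i: "i \<in> ?S" and j: "j \<in> ?S" and eq: "i div p = j div p"
    have "[s + m * i = s + m * j] (mod p)"
      using i j by (metis (mono_tags, lifting) cong_0_iff cong_sym cong_trans mem_Collect_eq)
    then have "[i = j] (mod p)"
      using assms(1) by (simp add: cong_add_lcancel_nat cong_mult_lcancel_nat coprime_commute)
    then have "i mod p = j mod p" by (simp add: unique_euclidean_semiring_class.cong_def)
    then show "i = j" using eq by (metis div_mult_mod_eq)
  qed
  moreover have "(\<lambda>j. j div p) ` ?S \<subseteq> {..n div p}"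
    by (auto intro: div_le_mono)
  ultimately have "card ?S \<le> n div p + 1"
    using card_inj_on_le[of "\<lambda>j. j div p" ?S "{..n div p}"] by simp
  then have "real (card ?S) \<le> real (n div p) + 1" by linarith
  also have "\<dots> \<le> real n / real p + 1" by (simp add: of_nat_div_le_of_nat)
  finally show ?thesis .
qed

text \<open>Telescoping, since 1/(n+1)^2 \<le> 1/n - 1/(n+1).\<close>

lemma sum_inverse_squares_le:
  assumes "m > 0" "m \<le> n"
  shows "(\<Sum>p=Suc m..n. 1 / real p ^ 2) \<le> 1 / real m - 1 / real n"
  using assms(2)
proof (induction n rule: dec_induct)
  case (step n)
  have "1 / real (Suc n) ^ 2 \<le> 1 / real n - 1 / real (Suc n)"
    using step(1) assms(1) by (simp add: divide_simps power2_eq_square)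
  then show ?case using step by simp
qed simp

lemma sum_inverse_le_ln:
  assumes "n \<ge> 1"
  shows "(\<Sum>p=2..n. 1 / real p) \<le> ln (real n)"
  using assms
proof (induction n rule: dec_induct)
  case (step n)
  have "ln (real n / real (Suc n)) \<le> real n / real (Suc n) - 1"
    using step(1) by (intro ln_le_minus_one) simp
  also have "\<dots> = - (1 / real (Suc n))" by (simp add: field_simps)
  finally have "1 / real (Suc n) \<le> ln (real (Suc n)) - ln (real n)"
    using step(1) by (simp add: ln_div)
  then show ?case using step by simp
qed simp

text \<open>A union bound: a pair that is not coprime has a common prime p, which is at least 7 by
  \<open>small\<close>. For such p, both 10 and \<open>m\<close> are invertible modulo p, so at most
  (K/p + 1) * (J/p + 1) pairs are lost to it.\<close>

lemma card_coprime_pairs_ge: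
  fixes K J m :: nat and s :: "nat \<Rightarrow> nat"
  assumes K: "K > 0"
    and m: "\<And>p. prime p \<Longrightarrow> p dvd m \<Longrightarrow> p < 7"
    and small: "\<And>p k j. prime p \<Longrightarrow> p < 7 \<Longrightarrow> p dvd 10 * k + 1 \<Longrightarrow> \<not> p dvd s k + m * j"
  shows "real (card {(k, j). k < K \<and> j < J \<and> coprime (10 * k + 1) (s k + m * j)})
    \<ge> 5 / 6 * real K * real J - (real K + real J) * ln (real (10 * K)) - real (10 * K)"
proof -
  define P where "P = {p. prime p \<and> 7 \<le> p \<and> p \<le> 10 * K}"
  define G where "G = {(k, j). k < K \<and> j < J \<and> coprime (10 * k + 1) (s k + m * j)}"
  \<comment> \<open>A dependent sum, because the offset \<open>s k\<close> of the second progression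
    varies with \<open>k\<close>. The order \<open>1 + 10 * k\<close> fits the pattern of
    \<open>card_dvd_progression_le\<close>.\<close>
  define D where "D p = (SIGMA k:{k. k < K \<and> p dvd 1 + 10 * k}. {j. j < J \<and> p dvd s k + m * j})" for p
  have P: "P \<subseteq> {7..10*K}" "finite P" by (auto simp: P_def)
  have finG: "finite G"
    by (rule finite_subset[of _ "{..<K} \<times> {..<J}"]) (auto simp: G_def)
  have finD: "finite (D p)" for p by (simp add: D_def)
  have cover: "{..<K} \<times> {..<J} \<subseteq> G \<union> (\<Union>p\<in>P. D p)"
  proof (intro subrelI UnCI)
    fix k j assume "(k, j) \<in> {..<K} \<times> {..<J}" and nD: "(k, j) \<notin> (\<Union>p\<in>P. D p)"
    then have kj: "k \<in> {..<K}" "j \<in> {..<J}" by auto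
    have "coprime (10 * k + 1) (s k + m * j)"
    proof (rule ccontr)
      assume "\<not> coprime (10 * k + 1) (s k + m * j)"
      then have "gcd (10 * k + 1) (s k + m * j) \<noteq> 1" by (simp add: coprime_iff_gcd_eq_1)
      then obtain p where p: "prime p" "p dvd gcd (10 * k + 1) (s k + m * j)"
        using prime_factor_nat by blast
      then have dv: "p dvd 10 * k + 1" "p dvd s k + m * j" by auto
      then have "7 \<le> p" using small[OF p(1)] by force
      \<comment> \<open>As k < K, the number 10 * k + 1 is below 10 * K, so only finitely many
        primes have to be removed.\<close>
      moreover have "p \<le> 10 * K" using dvd_imp_le[OF dv(1)] kj by simp
      ultimately have "p \<in> P" using p by (simp add: P_def)
      moreover have "(k, j) \<in> D p" using kj dv by (simp add: D_def)
      ultimately show False using nD by blast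
    qed
    then show "(k, j) \<in> G" using kj by (simp add: G_def)
  qed
  have Dle: "real (card (D p)) \<le> (real K / real p + 1) * (real J / real p + 1)" if "p \<in> P" for p
  proof -
    have p: "prime p" "7 \<le> p" using that by (auto simp: P_def)
    have "coprime p m" using p m[of p] by (intro prime_imp_coprime) auto
    have "\<not> p dvd 10"
    proof
      assume "p dvd 10"
      then have "p dvd 2 * 5" by simp
      then have "p dvd 2 \<or> p dvd 5" using p(1) by (simp only: prime_dvd_mult_iff)
      then show False using p(2) by (auto dest: dvd_imp_le)
    qed
    then have "coprime p 10" using p by (intro prime_imp_coprime) auto
    have "real (card (D p)) = (\<Sum>k | k < K \<and> p dvd 1 + 10 * k. real (card {j. j < J \<and> p dvd s k + m * j}))"
      by (simp add: D_def)
    also have "\<dots> \<le> (\<Sum>k | k < K \<and> p dvd 1 + 10 * k. real J / real p + 1)"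
      using \<open>coprime p m\<close> p by (intro sum_mono card_dvd_progression_le) auto
    also have "\<dots> = real (card {k. k < K \<and> p dvd 1 + 10 * k}) * (real J / real p + 1)"
      by simp
    also have "\<dots> \<le> (real K / real p + 1) * (real J / real p + 1)"
      using \<open>coprime p 10\<close> p by (intro mult_right_mono card_dvd_progression_le) auto
    finally show ?thesis .
  qed
  have "real K * real J = real (card ({..<K} \<times> {..<J}))" by simp
  also have "\<dots> \<le> real (card G + card (\<Union>p\<in>P. D p))"
    using card_mono[OF _ cover] card_Un_le[of G "\<Union>p\<in>P. D p"] finG finD P
    by (intro of_nat_mono) fastforce
  also have "card (\<Union>p\<in>P. D p) \<le> (\<Sum>p\<in>P. card (D p))"
    using P by (intro card_UN_le)
  finally have "real K * real J \<le> real (card G) + (\<Sum>p\<in>P. real (card (D p)))" by simp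
  also have "(\<Sum>p\<in>P. real (card (D p)))
      \<le> (\<Sum>p\<in>P. (real K / real p + 1) * (real J / real p + 1))"
    by (intro sum_mono Dle)
  also have "\<dots> = real K * real J * (\<Sum>p\<in>P. 1 / real p ^ 2)
      + (real K + real J) * (\<Sum>p\<in>P. 1 / real p) + real (card P)"
  proof -
    have "(real K / real p + 1) * (real J / real p + 1)
        = real K * real J * (1 / real p ^ 2) + (real K + real J) * (1 / real p) + 1" for p
      by (simp add: algebra_simps add_divide_distrib power2_eq_square)
    then show ?thesis by (simp only: sum.distrib sum_distrib_left) simp
  qed
  \<comment> \<open>Each sum over primes is enlarged to a sum over integers. The inverse squares
    from 7 on add up to at most 1/6, which leaves 5/6 of all pairs as the main term.\<close>
  also have "\<dots> \<le> real K * real J * (1 / 6) + (real K + real J) * ln (real (10 * K)) + real (10 * K)"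
  proof (intro add_mono mult_left_mono)
    have "(\<Sum>p\<in>P. 1 / real p ^ 2) \<le> (\<Sum>p=Suc 6..10*K. 1 / real p ^ 2)"
      using P by (intro sum_mono2) auto
    also have "\<dots> \<le> 1 / real 6 - 1 / real (10 * K)"
      using K by (intro sum_inverse_squares_le) auto
    also have "\<dots> \<le> 1 / 6" by simp
    finally show "(\<Sum>p\<in>P. 1 / real p ^ 2) \<le> 1 / 6" .
    have "(\<Sum>p\<in>P. 1 / real p) \<le> (\<Sum>p=2..10*K. 1 / real p)"
      using P by (intro sum_mono2) auto
    also have "\<dots> \<le> ln (real (10 * K))" using K by (intro sum_inverse_le_ln) simp
    finally show "(\<Sum>p\<in>P. 1 / real p) \<le> ln (real (10 * K))" .
    have "card P \<le> card {7..10*K}" using P by (intro card_mono) auto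
    then show "real (card P) \<le> real (10 * K)" by simp
  qed simp_all
  finally show ?thesis unfolding G_def by (simp add: algebra_simps)
qed

section \<open>The construction\<close>

text \<open>Modulo 5^z the power 2^x is invertible, which fixes the residue of \<open>s\<close>; the
  Chinese remainder theorem adds the condition modulo 3. The result serves as the starting point of
  the progression for A / 2^x.\<close>

lemma simultaneous_residue_exists:
  assumes "z > 0"
  obtains s :: nat where "s < 3 * 5 ^ z" "[s = 1] (mod 3)" "5 ^ z dvd 2 ^ x * s + B"
proof -
  have "coprime (2 ^ x) (5 ^ z :: nat)" by (simp add: coprime_commute)
  then obtain u where u: "[2 ^ x * u = 1] (mod 5 ^ z :: nat)"
    using cong_solve_coprime_nat[of "2 ^ x" "5 ^ z"] by auto
  \<comment> \<open>The factor \<open>B * (5 ^ z - 1)\<close> stands for -B modulo 5^z within the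
    natural numbers.\<close>
  define v where "v = u * (B * (5 ^ z - 1))"
  have "coprime (3::nat) 5" by (intro primes_coprime) auto
  then have "coprime 3 (5 ^ z :: nat)" by simp
  then obtain s where s: "s < 3 * 5 ^ z" "[s = 1] (mod 3)" "[s = v] (mod 5 ^ z)"
    using binary_chinese_remainder_unique_nat[of 3 "5 ^ z" 1 v] by auto
  have "[2 ^ x * s + B = 2 ^ x * v + B] (mod 5 ^ z)"
    using s(3) by (intro cong_add cong_mult cong_refl)
  also have "2 ^ x * v + B = (2 ^ x * u) * (B * (5 ^ z - 1)) + B"
    by (simp add: v_def)
  also have "[\<dots> = 1 * (B * (5 ^ z - 1)) + B] (mod 5 ^ z)"
    using u by (intro cong_add cong_mult cong_refl)
  also have "1 * (B * (5 ^ z - 1)) + B = B * 5 ^ z"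
    by (simp add: diff_mult_distrib2)
  also have "[B * 5 ^ z = 0] (mod 5 ^ z)" by (simp add: cong_0_iff)
  finally have "5 ^ z dvd 2 ^ x * s + B" by (simp add: cong_0_iff)
  with s show ?thesis by (intro that)
qed

text \<open>The triples are A = 2^x * (s k + m * j), B = 3^y * (10 * k + 1), C = -(A + B), with
  \<open>s k\<close> chosen so that 5^z divides C. The factor 2 in \<open>J\<close> and
  \<open>K\<close> keeps A and B below N/2, hence |C| \<le> N.\<close>

lemma abc_count_ge:
  fixes a b c :: real and N K J x y z :: nat
  assumes abc: "a \<le> 1" "b \<le> 1" "c \<le> 1"
    and pos: "x > 0" "y > 0" "z > 0" "K > 0"
    and x: "2 * real N powr (1 - a) \<le> 2 ^ x"
    and y: "3 * real N powr (1 - b) \<le> 3 ^ y"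
    and z: "5 * real N powr (1 - c) \<le> 5 ^ z"
    and J: "2 ^ x * (3 * 5 ^ z) * J * 2 \<le> N"
    and K: "3 ^ y * 10 * K * 2 \<le> N"
  shows "real (abc_count a b c N)
    \<ge> 5 / 6 * real K * real J - (real K + real J) * ln (real (10 * K)) - real (10 * K)"
proof -
  have "\<exists>s. s < 3 * 5 ^ z \<and> [s = 1] (mod 3) \<and> 5 ^ z dvd 2 ^ x * s + 3 ^ y * (10 * k + 1)"
    for k :: nat
    by (rule simultaneous_residue_exists[OF pos(3), of x "3 ^ y * (10 * k + 1)"]) blast
  then obtain s :: "nat \<Rightarrow> nat" where s: "\<And>k. s k < 3 * 5 ^ z" "\<And>k. [s k = 1] (mod 3)"
    "\<And>k. 5 ^ z dvd 2 ^ x * s k + 3 ^ y * (10 * k + 1)" by metis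
  \<comment> \<open>Steps of length 3 * 5^z change neither the residue modulo 3 nor the divisibility
    of C by 5^z, and have no prime factor \<ge> 7.\<close>
  define m :: nat where "m = 3 * 5 ^ z"
  define G where "G = {(k, j). k < K \<and> j < J \<and> coprime (10 * k + 1) (s k + m * j)}"
  define A :: "nat \<Rightarrow> nat \<Rightarrow> nat" where "A k j = 2 ^ x * (s k + m * j)" for k j
  define B :: "nat \<Rightarrow> nat" where "B k = 3 ^ y * (10 * k + 1)" for k
  define F where "F = (\<lambda>(k, j). (int (A k j), int (B k), - int (A k j + B k)))"

  have small_primes: "p = 2 \<or> p = 3 \<or> p = 5" if "prime p" "p < 7" for p :: nat
  proof -
    have "p = 0 \<or> p = 1 \<or> p = 2 \<or> p = 3 \<or> p = 4 \<or> p = 5 \<or> p = 6"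
      using that(2) by presburger
    moreover have "\<not> prime (4::nat)" "\<not> prime (6::nat)"
      by (auto simp: prime_nat_iff intro!: exI[of _ 2])
    moreover have "\<not> prime (0::nat)" "\<not> prime (1::nat)" by auto
    ultimately show ?thesis using that(1) by metis
  qed
  have n3: "\<not> 3 dvd s k + m * j" for k j
  proof -
    have "[s k + m * j = 1 + 0] (mod 3)"
      using s(2) by (intro cong_add) (auto simp: m_def cong_0_iff)
    then show ?thesis using cong_dvd_iff[of "s k + m * j" "1 + 0" 3] by simp
  qed
  \<comment> \<open>The form 10 * k + 1 excludes 2 and 5 as common primes, and \<open>n3\<close>
    excludes 3. This is the hypothesis \<open>small\<close> of the counting lemma.\<close>
  have n25: "\<not> 2 dvd 10 * k + 1" "\<not> 5 dvd 10 * k + 1" for k :: nat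
    by presburger+
  have G: "real (card G)
    \<ge> 5 / 6 * real K * real J - (real K + real J) * ln (real (10 * K)) - real (10 * K)"
    unfolding G_def
  proof (rule card_coprime_pairs_ge)
    fix p :: nat assume p: "prime p" "p dvd m"
    then have "p dvd 3 \<or> p dvd 5"
      by (metis m_def prime_dvd_mult_iff prime_dvd_power)
    then show "p < 7" by (auto dest: dvd_imp_le)
  next
    fix p k j :: nat assume "prime p" "p < 7" "p dvd 10 * k + 1"
    then show "\<not> p dvd s k + m * j"
      using small_primes[of p] n25[of k] n3[of k j] by auto
  qed (use pos in simp)

  have inj: "inj_on F G"
  proof (rule inj_onI, clarify)
    fix k j k' j' assume F: "F (k, j) = F (k', j')"
    then have "k = k'" by (simp add: F_def B_def)
    with F show "k = k' \<and> j = j'" by (simp add: F_def A_def m_def)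
  qed
  have "F ` G \<subseteq> abc_triples a b c N"
  proof clarify
    fix k j A' B' C' assume kj: "(k, j) \<in> G" and F: "(A', B', C') = F (k, j)"
    have k: "k < K" and j: "j < J" and cop: "coprime (10 * k + 1) (s k + m * j)"
      using kj by (auto simp: G_def)
    have A0: "A k j > 0" using n3[of k j] by (auto simp: A_def intro!: gr0I)
    have B0: "B k > 0" by (simp add: B_def)
    \<comment> \<open>The offset is less than one step \<open>m\<close>, so the term with index
      \<open>j\<close> is below m * (j + 1), and j + 1 \<le> J.\<close>
    have "s k + m * j \<le> m * Suc j" using s(1)[of k] by (simp add: m_def)
    also have "\<dots> \<le> m * J" using j by (intro mult_le_mono2) simp
    finally have "A k j \<le> 2 ^ x * (m * J)" unfolding A_def by (rule mult_le_mono2)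
    then have AN: "A k j * 2 \<le> N" using J by (simp add: m_def mult.assoc)
    have "10 * k + 1 \<le> 10 * K" using k by simp
    then have "B k \<le> 3 ^ y * (10 * K)" unfolding B_def by (rule mult_le_mono2)
    then have BN: "B k * 2 \<le> N" using K by (simp add: mult.assoc)
    have coprime: "coprime (A k j) (B k)"
    proof -
      have "coprime 2 (10 * k + 1)"
        using n25(1)[of k] by (intro prime_imp_coprime) auto
      moreover have "coprime 3 (s k + m * j)"
        using n3[of k j] by (intro prime_imp_coprime) auto
      moreover have "coprime 2 (3::nat)" by simp
      ultimately show ?thesis using cop
        by (simp only: A_def B_def coprime_mult_left_iff coprime_mult_right_iff
            coprime_power_left_iff coprime_power_right_iff) (simp add: coprime_commute)
    qed
    have dvdC: "5 ^ z dvd A k j + B k"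
    proof -
      have "A k j + B k = (2 ^ x * s k + 3 ^ y * (10 * k + 1)) + 5 ^ z * (2 ^ x * 3 * j)"
        by (simp add: A_def B_def m_def algebra_simps)
      then show ?thesis using s(3)[of k] by (metis dvd_add dvd_triv_left)
    qed
    have dvds: "int (2 ^ x) dvd int (A k j)" "int (3 ^ y) dvd int (B k)"
      "int (5 ^ z) dvd int (A k j + B k)"
      using dvdC by (simp_all only: of_nat_dvd_iff) (simp_all add: A_def B_def)
    have radA: "real_of_int (rad (int (A k j))) \<le> real_of_int \<bar>int (A k j)\<bar> powr a"
      using A0 AN x abc pos dvds(1) by (intro rad_le_powr[of 2 x _ "real N"]) auto
    have radB: "real_of_int (rad (int (B k))) \<le> real_of_int \<bar>int (B k)\<bar> powr b"
      using B0 BN y abc pos dvds(2) by (intro rad_le_powr[of 3 y _ "real N"]) auto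
    have "5 ^ z dvd - int (A k j + B k)"
      unfolding dvd_minus_iff using dvds(3) by simp
    then have radC: "real_of_int (rad (- int (A k j + B k)))
        \<le> real_of_int \<bar>- int (A k j + B k)\<bar> powr c"
      using A0 AN BN z abc pos by (intro rad_le_powr[of 5 z _ "real N"]) auto
    \<comment> \<open>C is a combination of A and B, so coprimality of A and B suffices.\<close>
    have "gcd (int (A k j)) (gcd (int (B k)) (- int (A k j) - int (B k))) = 1"
    proof -
      have "gcd (int (A k j)) (int (B k)) = 1"
        using coprime by (simp add: coprime_iff_gcd_eq_1[symmetric])
      then show ?thesis by (simp only: gcd.assoc[symmetric]) simp
    qed
    then show "(A', B', C') \<in> abc_triples a b c N"
      using F A0 B0 AN BN radA radB radC by (simp add: F_def abc_triples_def)
  qed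
  then have "card G \<le> abc_count a b c N"
    unfolding abc_count_def
    using card_inj_on_le[OF inj _ finite_abc_triples] by blast
  then show ?thesis using G by linarith
qed

section \<open>Choice of parameters and asymptotics\<close>

text \<open>The least n with t \<le> p^n has p^n \<le> p * t; one further factor p gives both
  bounds. The lower bound p * t is what \<open>rad_le_powr\<close> asks for, as the prime
  \<open>p\<close> itself survives in the radical.\<close>

lemma power_between:
  fixes p t :: real
  assumes "p > 1" "t \<ge> 1"
  obtains n :: nat where "n > 0" "p * t \<le> p ^ n" "p ^ n \<le> p ^ 2 * t"
proof -
  define n where "n = (LEAST n. t \<le> p ^ n)"
  have "\<exists>n. t \<le> p ^ n" using real_arch_pow[OF assms(1), of t] by (auto intro: less_imp_le)
  then have n: "t \<le> p ^ n" unfolding n_def by (rule LeastI_ex)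
  have "p ^ n \<le> p * t"
  proof (cases n)
    case 0
    then show ?thesis using assms mult_mono[of 1 p 1 t] by simp
  next
    case (Suc k)
    then have "\<not> t \<le> p ^ k" using not_less_Least[of k "\<lambda>n. t \<le> p ^ n"] by (simp add: n_def)
    then show ?thesis using Suc assms by simp
  qed
  then show ?thesis using n assms
    by (intro that[of "Suc n"]) (simp_all add: power2_eq_square)
qed

text \<open>Rounding down costs less than 1, and w - 1 \<ge> w / 2 once w \<ge> 2.\<close>

lemma floor_quotient_ge:
  fixes N D :: nat and w :: real
  assumes "D > 0" "w \<ge> 2" "w * real D \<le> real N"
  shows "real (N div D) \<ge> w / 2"
proof -
  have "w \<le> real N / real D" using assms by (simp add: field_simps)
  moreover have "real N / real D < real (N div D) + 1"
    using floor_correct[of "real N / real D"] by (simp add: floor_divide_of_nat_eq)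
  ultimately show ?thesis using assms by linarith
qed

lemma abc_count_bigomega:
  fixes a b c :: real
  assumes a: "a \<le> 1" and b: "0 < b" "b \<le> 1" and c: "c \<le> 1" and ac: "a + c > 1"
  shows "(\<lambda>N::nat. real (abc_count a b c N)) \<in> \<Omega>(\<lambda>N. real N powr (a + b + c - 1))"
proof -
  define d where "d = a + c - 1"
  have d: "d > 0" using ac by (simp add: d_def)
  have powr_top: "filterlim (\<lambda>N::nat. real N powr e) at_top at_top" if "e > 0" for e
    using that by real_asymp
  have ln_le: "eventually (\<lambda>N::nat. ln (real N) \<le> \<epsilon> * real N powr e) at_top"
    if "e > 0" "\<epsilon> > 0" for e \<epsilon> :: real
  proof -
    have "(\<lambda>N::nat. ln (real N)) \<in> o(\<lambda>N. real N powr e)" using that(1) by real_asymp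
    then have "eventually (\<lambda>N::nat. norm (ln (real N)) \<le> \<epsilon> * norm (real N powr e)) at_top"
      using that(2) by (rule landau_o.smallD)
    then show ?thesis by (rule eventually_mono) auto
  qed
  \<comment> \<open>The thresholds fit J \<ge> N^d / 1200 and K \<ge> N^b / 360: they give J \<ge>
    120 and K \<ge> 1, and since 14400 = 12 * 1200 and 4320 = 12 * 360, the logarithm is at most J /
    12 and K / 12.\<close>
  have "eventually (\<lambda>N::nat. N \<ge> 1 \<and> real N powr d \<ge> 144000 \<and> real N powr b \<ge> 360
      \<and> ln (real N) \<le> 1 / 14400 * real N powr d \<and> ln (real N) \<le> 1 / 4320 * real N powr b) at_top"
    using d b powr_top[of d] powr_top[of b]
    by (intro eventually_conj ln_le eventually_ge_at_top) (auto simp: filterlim_at_top)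
  then have "eventually (\<lambda>N::nat. real (abc_count a b c N) \<ge> 1 / 864000 * real N powr (a + b + c - 1)) at_top"
  proof (rule eventually_mono, elim conjE)
    fix N :: nat
    assume N: "N \<ge> 1" and u: "real N powr d \<ge> 144000" and v: "real N powr b \<ge> 360"
      and lu: "ln (real N) \<le> 1 / 14400 * real N powr d"
      and lv: "ln (real N) \<le> 1 / 4320 * real N powr b"
    have ge1: "real N powr (1 - t) \<ge> 1" if "t \<le> 1" for t
      using N that by (intro ge_one_powr_ge_zero) auto
    obtain x where x: "x > 0" "2 * real N powr (1 - a) \<le> 2 ^ x" "2 ^ x \<le> 2\<^sup>2 * real N powr (1 - a)"
      using power_between[of 2 "real N powr (1 - a)"] ge1[OF a] by auto
    obtain y where y: "y > 0" "3 * real N powr (1 - b) \<le> 3 ^ y" "3 ^ y \<le> 3\<^sup>2 * real N powr (1 - b)"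
      using power_between[of 3 "real N powr (1 - b)"] ge1[OF b(2)] by auto
    obtain z where z: "z > 0" "5 * real N powr (1 - c) \<le> 5 ^ z" "5 ^ z \<le> 5\<^sup>2 * real N powr (1 - c)"
      using power_between[of 5 "real N powr (1 - c)"] ge1[OF c] by auto
    define J where "J = N div (2 ^ x * (3 * 5 ^ z) * 2)"
    define K where "K = N div (3 ^ y * 10 * 2)"
    \<comment> \<open>The divisor is at most 6 * 4 * 25 * N^(2-a-c) = 600 * N^(1-d), and rounding
      down costs a factor 2.\<close>
    have J: "real J \<ge> real N powr d / 1200"
    proof -
      have "real J \<ge> (real N powr d / 600) / 2" unfolding J_def
      proof (rule floor_quotient_ge)
        have "real N powr d / 600 * real (2 ^ x * (3 * 5 ^ z) * 2)
            = real N powr d / 100 * (2 ^ x * 5 ^ z)" by simp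
        also have "\<dots> \<le> real N powr d / 100 * ((2\<^sup>2 * real N powr (1 - a)) * (5\<^sup>2 * real N powr (1 - c)))"
          using x z by (intro mult_left_mono mult_mono) auto
        also have "\<dots> = real N powr d * real N powr (1 - a) * real N powr (1 - c)" by simp
        also have "\<dots> = real N" using N by (simp add: d_def flip: powr_add)
        finally show "real N powr d / 600 * real (2 ^ x * (3 * 5 ^ z) * 2) \<le> real N" .
      qed (use u in auto)
      then show ?thesis by simp
    qed
    \<comment> \<open>Here the divisor is at most 20 * 9 * N^(1-b) = 180 * N^(1-b).\<close>
    have K: "real K \<ge> real N powr b / 360"
    proof -
      have "real K \<ge> (real N powr b / 180) / 2" unfolding K_def
      proof (rule floor_quotient_ge)
        have "real N powr b / 180 * real (3 ^ y * 10 * 2) = real N powr b / 9 * 3 ^ y" by simp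
        also have "\<dots> \<le> real N powr b / 9 * (3\<^sup>2 * real N powr (1 - b))"
          using y by (intro mult_left_mono) auto
        also have "\<dots> = real N" using N by (simp flip: powr_add)
        finally show "real N powr b / 180 * real (3 ^ y * 10 * 2) \<le> real N" .
      qed (use v in auto)
      then show ?thesis by simp
    qed
    have K0: "K > 0" using K v by (cases K) auto
    have JN: "2 ^ x * (3 * 5 ^ z) * J * 2 \<le> N"
      using div_times_less_eq_dividend[of N "2 ^ x * (3 * 5 ^ z) * 2"]
      by (simp add: J_def mult_ac)
    have KN: "3 ^ y * 10 * K * 2 \<le> N"
      using div_times_less_eq_dividend[of N "3 ^ y * 10 * 2"] by (simp add: K_def mult_ac)
    have "10 * K \<le> 3 ^ y * 10 * K * 2" by simp
    then have "10 * K \<le> N" using KN by (rule order_trans)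
    then have "ln (real (10 * K)) \<le> ln (real N)"
      using K0 by (subst ln_le_cancel_iff) (simp_all flip: of_nat_mult)
    then have lnJ: "ln (real (10 * K)) \<le> real J / 12" and lnK: "ln (real (10 * K)) \<le> real K / 12"
      using lu lv J K by linarith+
    have J120: "120 \<le> real J" using J u by linarith
    have "1 / 864000 * real N powr (a + b + c - 1) = 1 / 2 * ((real N powr b / 360) * (real N powr d / 1200))"
      by (simp add: d_def flip: powr_add) (simp add: algebra_simps)
    also have "\<dots> \<le> 1 / 2 * (real K * real J)"
      using J K by (intro mult_left_mono mult_mono) auto
    \<comment> \<open>Each of the three error terms K * ln(10K), J * ln(10K) and 10K is at most K *
      J / 12, so 5/6 - 3/12 = 7/12 of K * J remains.\<close>
    also have "\<dots> \<le> 5 / 6 * real K * real J - (real K + real J) * ln (real (10 * K)) - real (10 * K)"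
    proof -
      have "real K * ln (real (10 * K)) \<le> real K * (real J / 12)"
        by (intro mult_left_mono lnJ) simp
      moreover have "real J * ln (real (10 * K)) \<le> real J * (real K / 12)"
        by (intro mult_left_mono lnK) simp
      moreover have "real K * 120 \<le> real K * real J" using J120 by (intro mult_left_mono) auto
      ultimately show ?thesis by (simp add: algebra_simps)
    qed
    also have "\<dots> \<le> real (abc_count a b c N)"
      by (intro abc_count_ge[OF a b(2) c x(1) y(1) z(1) K0 x(2) y(2) z(2) JN KN])
    finally show "real (abc_count a b c N) \<ge> 1 / 864000 * real N powr (a + b + c - 1)" .
  qed
  then show ?thesis
    by (intro landau_omega.bigI[of "1 / 864000"]) (auto elim: eventually_mono)
qed

lemma abc_count_swap: "abc_count a b c N = abc_count a c b N"
proof -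
  have "bij_betw (\<lambda>(A, B, C). (A, C, B)) (abc_triples a b c N) (abc_triples a c b N)"
    by (rule bij_betw_byWitness[where f' = "\<lambda>(A, B, C). (A, C, B)"])
      (auto simp: abc_triples_def insert_commute gcd.left_commute gcd.commute)
  then show ?thesis unfolding abc_count_def by (rule bij_betw_same_card)
qed

theorem theorem2:
  fixes a b c :: real
  assumes "0 < a" "a \<le> 1"
    and "0 < b" "b \<le> 1"
    and "0 < c" "c \<le> 1"
    and "Min {a, b, c} + Max {a, b, c} > 1"
  shows "(\<lambda>N::nat. real (abc_count a b c N)) \<in> \<Omega>(\<lambda>N. real N powr (a + b + c - 1))"
proof -
  \<comment> \<open>If \<open>a\<close> is the maximum, the minimum is attained at \<open>b\<close>
    or \<open>c\<close>. Otherwise the maximum is attained there, and \<open>a\<close> is at least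
    the minimum.\<close>
  have "a + c > 1 \<or> a + b > 1"
    using assms(7) by (auto simp: min_def max_def split: if_splits)
  then show ?thesis
  proof
    assume "a + c > 1"
    then show ?thesis using assms by (intro abc_count_bigomega)
  next
    assume "a + b > 1"
    then have "(\<lambda>N::nat. real (abc_count a c b N)) \<in> \<Omega>(\<lambda>N. real N powr (a + c + b - 1))"
      using assms by (intro abc_count_bigomega)
    then show ?thesis
      by (simp only: abc_count_swap[of a b c] add.assoc add.commute[of b c])
  qed
qed

end
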